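(* Let $A\subset\mathbb{R}^n$ be a nonempty compact set, let $N\ge 1$, and let $f:[0,\infty)\to[0,\infty)$ be continuous and strictly monotonically decreasing. Let $\varepsilon_\Lambda,\varepsilon_\Gamma>0$, let $\Lambda$ be an $\varepsilon_\Lambda$-net of $\operatorname{conv}(A)$ and let $\Gamma$ be an $\varepsilon_\Gamma$-net of $A$. Let $(g_{c,p})_{c\in\operatorname{conv}(A),\,p\in A}$ be a family of control functions with respect to $f$ and $A$. Let $Y=\{y\in\{0,1,\dots,N\}^{\Lambda} : \sum_{c\in\Lambda}y_c=N\}$ and define $$L_1=\max\Bigl\{x\in\mathbb{R} : \exists\, y\in Y,\ x\le \sum_{c\in\Lambda}y_c\bigl(f(\|c-p\|)-g_{c,p}(\varepsilon_\Gamma)\bigr)\ \text{for all } p\in\Gamma\Bigr\},$$ $$L_2=\max\Bigl\{x\in\mathbb{R} : \exists\, y\in Y,\ x\le \sum_{c\in\Lambda}y_c\, f(\|c-p\|)\ \text{for all } p\in A\Bigr\},$$ $$U_2=\max\Bigl\{x\in\mathbb{R} : \exists\text{ a multiset } C \text{ of } N \text{ points of } \operatorname{conv}(A),\ x\le \sum_{c\in C} f(\|c-p\|)\ \text{for all } p\in\Gamma\Bigr\},$$ $$U_1=\max\Bigl\{x\in\mathbb{R} : \exists\, y\in Y,\ x\le \sum_{c\in\Lambda}y_c\bigl(f(\|c-p\|)+g_{c,p}(\varepsilon_\Lambda)\bigr)\ \text{for all } p\in\Gamma\Bigr\}.$$ Then $$L_1\le L_2\le \mathcal{P}_f(A)\le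 U_2\le U_1 .$$
   Context: The maximal polarization is $\mathcal{P}_f(A)=\sup_{C}\inf_{p\in A}\sum_{c\in C}f(\|p-c\|)$, the supremum being over all multisets $C$ of $N$ points of $\mathbb{R}^n$ (repetitions allowed, sums counted with multiplicity; $\|\cdot\|$ is the Euclidean norm). An $\varepsilon$-net of a set $X\subset\mathbb{R}^n$ is a finite subset $S\subset X$ such that for every $p\in X$ there is $s\in S$ with $\|s-p\|<\varepsilon$. A family of functions $g_{c,p}:[0,\infty)\to[0,\infty)$, for $c\in\operatorname{conv}(A)$ and $p\in A$, is a family of control functions (with respect to $f$, $A$) if for all $c\in\operatorname{conv}(A)$, $p\in A$: (1) $g_{c,p}(0)=0$; (2) $g_{c,p}$ is continuous and non-decreasing; (3) $|f(\|c-p\|)-f(\|c'-p\|)|\le g_{c,p}(\|c-c'\|)$ for all $c'\in\operatorname{conv}(A)$; (4) $|f(\|c-p\|)-f(\|c-p'\|)|\le g_{c,p}(\|p-p'\|)$ for all $p'\in A$. *)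

theory Defs
  imports "HOL-Analysis.Analysis" "HOL-Library.Multiset"
begin

text \<open>
  Functions on \<open>[0,\<infinity>)\<close> are total functions on the reals of which only the values on
  \<open>{0..}\<close> are ever constrained or used.
\<close>

text \<open>
  The supremum and infimum are those of the (conditionally complete) reals. They are the genuine
  ones when \<open>A\<close> is nonempty and \<open>f\<close> is nonnegative and decreasing on \<open>{0..}\<close>: all the sums
  then lie between \<open>0\<close> and \<open>N * f 0\<close>.
\<close>

definition polarization :: "nat \<Rightarrow> (real \<Rightarrow> real) \<Rightarrow> (real ^ 'n) set \<Rightarrow> real" where
  "polarization N f A =
     (SUP C\<in>{C :: (real ^ 'n) multiset. size C = N}. INF p\<in>A. \<Sum>c\<in>#C. f (norm (p - c)))"

definition eps_net :: "real \<Rightarrow> (real ^ 'n) set \<Rightarrow> (real ^ 'n) set \<Rightarrow> bool" where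
  "eps_net \<epsilon> X S \<longleftrightarrow> finite S \<and> S \<subseteq> X \<and> (\<forall>p\<in>X. \<exists>s\<in>S. norm (s - p) < \<epsilon>)"

definition control_functions ::
  "(real \<Rightarrow> real) \<Rightarrow> (real ^ 'n) set \<Rightarrow> (real ^ 'n \<Rightarrow> real ^ 'n \<Rightarrow> real \<Rightarrow> real) \<Rightarrow> bool" where
  "control_functions f A g \<longleftrightarrow>
     (\<forall>c\<in>convex hull A. \<forall>p\<in>A.
        g c p \<in> {0..} \<rightarrow> {0..} \<and>
        g c p 0 = 0 \<and>
        continuous_on {0..} (g c p) \<and> mono_on {0..} (g c p) \<and>
        (\<forall>c'\<in>convex hull A. \<bar>f (norm (c - p)) - f (norm (c' - p))\<bar> \<le> g c p (norm (c - c'))) \<and>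
        (\<forall>p'\<in>A. \<bar>f (norm (c - p)) - f (norm (c - p'))\<bar> \<le> g c p (norm (p - p'))))"

definition weights :: "nat \<Rightarrow> (real ^ 'n) set \<Rightarrow> (real ^ 'n \<Rightarrow> nat) set" where
  "weights N \<Lambda> = {y \<in> \<Lambda> \<rightarrow>\<^sub>E {0..N}. (\<Sum>c\<in>\<Lambda>. y c) = N}"

text \<open>\<^const>\<open>Max\<close> is only meaningful for finite sets, so maxima of infinite sets are
  expressed by a predicate.\<close>

definition is_maximum :: "real set \<Rightarrow> real \<Rightarrow> bool" where
  "is_maximum S m \<longleftrightarrow> m \<in> S \<and> (\<forall>x\<in>S. x \<le> m)"

end

theory Submission
  imports Defs
begin

text \<open>
  Identifying a weight vector with the multiset in which \<open>c\<close> has multiplicity \<open>y c\<close>, all four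
  maxima range over multisets of \<open>N\<close> points of a compact set, namely \<open>\<Lambda>\<close> or the convex hull of
  \<open>A\<close>; they are attained because such multisets are sequentially compact. For the outer
  inequalities, replacing a point of \<open>A\<close> (of the convex hull) by a nearby point of the net changes
  each summand by at most the value of the control function. For the upper bound on the
  polarization, moving each point of a configuration to its projection on the convex hull
  does not increase its distance to any point of \<open>A\<close>.
\<close>

section \<open>Weight vectors as multisets\<close>

definition msets_in :: "nat \<Rightarrow> 'a set \<Rightarrow> 'a multiset set" where
  "msets_in N K = {C. size C = N \<and> set_mset C \<subseteq> K}"

lemma sum_mset_eq_sum_count:
  fixes h :: "'a \<Rightarrow> 'b::semiring_1"
  assumes "finite S" "set_mset C \<subseteq> S"
  shows "(\<Sum>c\<in>#C. h c) = (\<Sum>c\<in>S. of_nat (count C c) * h c)"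
  using assms(2)
proof (induction C)
  case (add a C)
  have "(\<Sum>c\<in>S. of_nat (count (add_mset a C) c) * h c)
      = (\<Sum>c\<in>S. (if c = a then h c else 0) + of_nat (count C c) * h c)"
    by (intro sum.cong) (auto simp: algebra_simps)
  also have "\<dots> = h a + (\<Sum>c\<in>S. of_nat (count C c) * h c)"
    using add.prems assms(1) by (simp add: sum.distrib)
  finally show ?case using add by simp
qed simp

text \<open>Members of \<open>weights\<close> are extensional, hence the \<open>restrict\<close>.
  The bound by \<open>N\<close> on each weight is automatic, since a multiplicity never exceeds the
  size.\<close>

lemma bij_betw_count_weights:
  fixes \<Lambda> :: "(real ^ 'n) set"
  assumes "finite \<Lambda>"
  shows "bij_betw (\<lambda>C. restrict (count C) \<Lambda>) (msets_in N \<Lambda>) (weights N \<Lambda>)"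
proof (rule bij_betw_byWitness[where f' = "\<lambda>y. \<Sum>c\<in>\<Lambda>. replicate_mset (y c) c"])
  have count_sum: "count (\<Sum>c\<in>\<Lambda>. replicate_mset (y c) c) a = (if a \<in> \<Lambda> then y a else 0)"
    for y :: "(real^'n) \<Rightarrow> nat" and a
    using assms by (simp add: count_sum)
  have size_count: "size C = (\<Sum>c\<in>\<Lambda>. count C c)" if "set_mset C \<subseteq> \<Lambda>" for C
    using sum_mset_eq_sum_count[OF assms that, of "\<lambda>_. 1::nat"]
    by simp
  have sub: "set_mset (\<Sum>c\<in>\<Lambda>. replicate_mset (y c) c) \<subseteq> \<Lambda>" for y :: "(real^'n) \<Rightarrow> nat"
    by (auto simp flip: count_greater_zero_iff simp: count_sum split: if_splits)
  show "\<forall>C\<in>msets_in N \<Lambda>. (\<Sum>c\<in>\<Lambda>. replicate_mset (restrict (count C) \<Lambda> c) c) = C"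
    by (auto simp: msets_in_def count_sum intro!: multiset_eqI)
      (metis count_inI subsetD)
  show "\<forall>y\<in>weights N \<Lambda>. restrict (count (\<Sum>c\<in>\<Lambda>. replicate_mset (y c) c)) \<Lambda> = y"
    by (auto simp: weights_def count_sum PiE_def extensional_def restrict_def)
  show "(\<lambda>C. restrict (count C) \<Lambda>) ` msets_in N \<Lambda> \<subseteq> weights N \<Lambda>"
    by (auto simp: msets_in_def weights_def count_le_size simp flip: size_count)
  show "(\<lambda>y. \<Sum>c\<in>\<Lambda>. replicate_mset (y c) c) ` weights N \<Lambda> \<subseteq> msets_in N \<Lambda>"
    using sub by (auto simp: msets_in_def weights_def size_count[OF sub] count_sum)
qed

text \<open>Summand and constraint set stay arbitrary, so that this one equivalence serves
  \<open>L\<^sub>1\<close>, \<open>L\<^sub>2\<close> and \<open>U\<^sub>1\<close>.\<close>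

lemma ex_weights_iff:
  assumes "finite \<Lambda>"
  shows "(\<exists>y\<in>weights N \<Lambda>. \<forall>p\<in>P. x \<le> (\<Sum>c\<in>\<Lambda>. real (y c) * h p c)) \<longleftrightarrow>
    (\<exists>C\<in>msets_in N \<Lambda>. \<forall>p\<in>P. x \<le> (\<Sum>c\<in>#C. h p c))"
proof -
  have "(\<Sum>c\<in>#C. h p c) = (\<Sum>c\<in>\<Lambda>. real (restrict (count C) \<Lambda> c) * h p c)"
    if "C \<in> msets_in N \<Lambda>" for C p
    using sum_mset_eq_sum_count[OF assms, of C "h p"] that by (simp add: msets_in_def)
  then show ?thesis
    by (simp flip: bij_betw_imp_surj_on[OF bij_betw_count_weights[OF assms]])
qed

section \<open>Compactness and attainment of maxima\<close>

text \<open>Convergence of multisets is tested by sums of continuous functions, which avoids a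
  topology on multisets. The subsequence is chosen before \<open>h\<close>, so one limit
  \<open>D\<close> works for all constraints at once. Induction on \<open>N\<close> splits off one
  point from each multiset.\<close>

lemma msets_in_seq_compact:
  fixes K :: "'a::topological_space set"
  assumes "seq_compact K" "\<And>k. C k \<in> msets_in N K"
  shows "\<exists>D\<in>msets_in N K. \<exists>r. strict_mono (r :: nat \<Rightarrow> nat) \<and>
    (\<forall>h::'a \<Rightarrow> real. continuous_on K h \<longrightarrow> (\<lambda>k. \<Sum>c\<in>#C (r k). h c) \<longlonglongrightarrow> (\<Sum>c\<in>#D. h c))"
  using assms(2)
proof (induction N arbitrary: C)
  case 0
  then show ?case
    by (intro bexI[where x = "{#}"] exI[where x = id]) (auto simp: msets_in_def strict_mono_def)
next
  case (Suc N)
  have "\<exists>c D. C k = add_mset c D" for k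
    using Suc.prems[of k] by (auto simp: msets_in_def size_eq_Suc_imp_eq_union)
  then obtain c D where CD: "\<And>k. C k = add_mset (c k) (D k)" by metis
  have c: "c k \<in> K" and D: "D k \<in> msets_in N K" for k
    using Suc.prems[of k] by (auto simp: CD msets_in_def)
  obtain E r where E: "E \<in> msets_in N K" and r: "strict_mono r"
    and lim: "\<And>h::'a \<Rightarrow> real. continuous_on K h \<Longrightarrow>
      (\<lambda>k. \<Sum>c\<in>#D (r k). h c) \<longlonglongrightarrow> (\<Sum>c\<in>#E. h c)"
    using Suc.IH[of D, OF D] by blast
  \<comment> \<open>The split-off points are refined along the subsequence \<open>r\<close> already
    found, so convergence of the remaining sums survives.\<close>
  obtain e s where e: "e \<in> K" and s: "strict_mono s" and lim_c: "((c \<circ> r) \<circ> s) \<longlonglongrightarrow> e"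
    using seq_compactE[OF assms(1), of "c \<circ> r"] c by auto
  have "(\<lambda>k. \<Sum>x\<in>#C ((r \<circ> s) k). h x) \<longlonglongrightarrow> (\<Sum>x\<in>#add_mset e E. h x)"
    if h: "continuous_on K h" for h :: "'a \<Rightarrow> real"
  proof -
    have "(\<lambda>k. h (c (r (s k)))) \<longlonglongrightarrow> h e"
      by (rule continuous_on_tendsto_compose[OF h _ e])
        (use lim_c c in \<open>auto simp: o_def\<close>)
    moreover have "(\<lambda>k. \<Sum>x\<in>#D (r (s k)). h x) \<longlonglongrightarrow> (\<Sum>x\<in>#E. h x)"
      using LIMSEQ_subseq_LIMSEQ[OF lim[OF h] s] by (simp add: o_def)
    ultimately show ?thesis by (simp add: CD tendsto_add)
  qed
  moreover have "add_mset e E \<in> msets_in (Suc N) K"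
    using e E by (auto simp: msets_in_def)
  ultimately show ?case using strict_mono_o[OF r s] by blast
qed

lemma sum_mset_bounds:
  fixes h :: "'a \<Rightarrow> real"
  assumes "C \<in> msets_in N K"
  shows "(\<And>c. c \<in> K \<Longrightarrow> h c \<le> b) \<Longrightarrow> (\<Sum>c\<in>#C. h c) \<le> real N * b"
    and "(\<And>c. c \<in> K \<Longrightarrow> b \<le> h c) \<Longrightarrow> real N * b \<le> (\<Sum>c\<in>#C. h c)"
  using sum_mset_mono[of C h "\<lambda>_. b"] sum_mset_mono[of C "\<lambda>_. b" h] assms
  by (auto simp: msets_in_def)

text \<open>The set of feasible values is nonempty, bounded above and closed, so it contains its
  supremum. The lower bound \<open>b\<close> is uniform in \<open>p\<close> because \<open>P\<close>
  may be infinite, as it may be for \<open>L\<^sub>2\<close>.\<close>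

lemma maximum_over_msets:
  fixes K :: "'a::metric_space set" and h :: "'b \<Rightarrow> 'a \<Rightarrow> real"
  assumes "compact K" "K \<noteq> {}" "P \<noteq> {}"
    and cont: "\<And>p. p \<in> P \<Longrightarrow> continuous_on K (h p)"
    and low: "\<And>p c. p \<in> P \<Longrightarrow> c \<in> K \<Longrightarrow> b \<le> h p c"
  shows "\<exists>m. is_maximum {x. \<exists>C\<in>msets_in N K. \<forall>p\<in>P. x \<le> (\<Sum>c\<in>#C. h p c)} m"
    (is "\<exists>m. is_maximum ?S m")
proof -
  obtain c\<^sub>0 p\<^sub>0 where c0: "c\<^sub>0 \<in> K" and p0: "p\<^sub>0 \<in> P" using assms by auto
  have "replicate_mset N c\<^sub>0 \<in> msets_in N K" using c0 by (auto simp: msets_in_def)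
  then have "real N * b \<in> ?S"
    using sum_mset_bounds(2)[where b = b] low by blast
  then have ne: "?S \<noteq> {}" by blast
  \<comment> \<open>A single constraint \<open>p\<^sub>0\<close> already bounds all feasible
    values.\<close>
  obtain d where d: "d \<in> K" "\<And>c. c \<in> K \<Longrightarrow> h p\<^sub>0 c \<le> h p\<^sub>0 d"
    using continuous_attains_sup[OF assms(1,2) cont[OF p0]] by blast
  have bdd: "bdd_above ?S"
  proof (rule bdd_aboveI)
    fix x assume "x \<in> ?S"
    then obtain C where "C \<in> msets_in N K" "x \<le> (\<Sum>c\<in>#C. h p\<^sub>0 c)" using p0 by blast
    then show "x \<le> real N * h p\<^sub>0 d"
      using sum_mset_bounds(1)[where h = "h p\<^sub>0" and b = "h p\<^sub>0 d"] d(2) by (meson order_trans)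
  qed
  have "closed ?S"
    unfolding closed_sequential_limits
  proof (intro allI impI, elim conjE)
    fix x l assume x: "\<forall>k. x k \<in> ?S" and l: "x \<longlonglongrightarrow> l"
    then obtain C where C: "\<And>k. C k \<in> msets_in N K"
      and le: "\<And>k p. p \<in> P \<Longrightarrow> x k \<le> (\<Sum>c\<in>#C k. h p c)"
      unfolding mem_Collect_eq Bex_def by metis
    obtain D r where D: "D \<in> msets_in N K" and r: "strict_mono r"
      and lim: "\<And>g::'a \<Rightarrow> real. continuous_on K g \<Longrightarrow>
        (\<lambda>k. \<Sum>c\<in>#C (r k). g c) \<longlonglongrightarrow> (\<Sum>c\<in>#D. g c)"
      using msets_in_seq_compact[OF compact_imp_seq_compact[OF assms(1)], of C N] C by blast
    have "l \<le> (\<Sum>c\<in>#D. h p c)" if "p \<in> P" for p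
      by (rule LIMSEQ_le[OF LIMSEQ_subseq_LIMSEQ[OF l r] lim[OF cont[OF that]]])
        (use le[OF that] in auto)
    then show "l \<in> ?S" using D by blast
  qed
  then have "Sup ?S \<in> ?S" by (rule closed_contains_Sup[OF ne bdd])
  then show ?thesis using cSup_upper[OF _ bdd] unfolding is_maximum_def by blast
qed

text \<open>Meant for \<open>L\<^sub>1\<close> and \<open>U\<^sub>1\<close>: control functions are
  not assumed continuous in \<open>c\<close>, but on a finite set every function is.\<close>

lemma maximum_over_msets_finite:
  fixes K :: "'a::metric_space set" and h :: "'b \<Rightarrow> 'a \<Rightarrow> real"
  assumes "finite K" "K \<noteq> {}" "finite P" "P \<noteq> {}"
  shows "\<exists>m. is_maximum {x. \<exists>C\<in>msets_in N K. \<forall>p\<in>P. x \<le> (\<Sum>c\<in>#C. h p c)} m"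
proof (rule maximum_over_msets)
  show "Min ((\<lambda>(p, c). h p c) ` (P \<times> K)) \<le> h p c" if "p \<in> P" "c \<in> K" for p c
    using that assms by (intro Min_le) auto
qed (use assms in \<open>simp_all add: finite_imp_compact continuous_on_finite\<close>)

section \<open>Projection onto the convex hull and the chain of inequalities\<close>

lemma closest_point_norm_le:
  fixes S :: "'a::euclidean_space set"
  assumes "closed S" "convex S" "p \<in> S"
  shows "norm (p - closest_point S c) \<le> norm (p - c)"
  using closest_point_lipschitz[OF assms(2,1), of p c] assms(3)
  by (auto simp: closest_point_self dist_norm)

theorem theorem3p5:
  fixes A \<Lambda> \<Gamma> :: "(real ^ 'n) set"
    and N :: nat
    and f :: "real \<Rightarrow> real"
    and g :: "real ^ 'n \<Rightarrow> real ^ 'n \<Rightarrow> real \<Rightarrow> real"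
    and \<epsilon>\<^sub>\<Lambda> \<epsilon>\<^sub>\<Gamma> :: real
  assumes "compact A" and "A \<noteq> {}"
    and "N \<ge> 1"
    and "f \<in> {0..} \<rightarrow> {0..}" and "continuous_on {0..} f" and "strict_antimono_on {0..} f"
    and "\<epsilon>\<^sub>\<Lambda> > 0" and "\<epsilon>\<^sub>\<Gamma> > 0"
    and "eps_net \<epsilon>\<^sub>\<Lambda> (convex hull A) \<Lambda>"
    and "eps_net \<epsilon>\<^sub>\<Gamma> A \<Gamma>"
    and "control_functions f A g"
  shows "\<exists>L\<^sub>1 L\<^sub>2 U\<^sub>2 U\<^sub>1.
      is_maximum {x. \<exists>y\<in>weights N \<Lambda>. \<forall>p\<in>\<Gamma>.
        x \<le> (\<Sum>c\<in>\<Lambda>. real (y c) * (f (norm (c - p)) - g c p \<epsilon>\<^sub>\<Gamma>))} L\<^sub>1 \<and>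
      is_maximum {x. \<exists>y\<in>weights N \<Lambda>. \<forall>p\<in>A.
        x \<le> (\<Sum>c\<in>\<Lambda>. real (y c) * f (norm (c - p)))} L\<^sub>2 \<and>
      is_maximum {x. \<exists>C. size C = N \<and> set_mset C \<subseteq> convex hull A \<and> (\<forall>p\<in>\<Gamma>.
        x \<le> (\<Sum>c\<in>#C. f (norm (c - p))))} U\<^sub>2 \<and>
      is_maximum {x. \<exists>y\<in>weights N \<Lambda>. \<forall>p\<in>\<Gamma>.
        x \<le> (\<Sum>c\<in>\<Lambda>. real (y c) * (f (norm (c - p)) + g c p \<epsilon>\<^sub>\<Lambda>))} U\<^sub>1 \<and>
      L\<^sub>1 \<le> L\<^sub>2 \<and> L\<^sub>2 \<le> polarization N f A \<and> polarization N f A \<le> U\<^sub>2 \<and> U\<^sub>2 \<le> U\<^sub>1"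
proof -
  let ?H = "convex hull A"
  let ?S = "\<lambda>K P h. {x. \<exists>C\<in>msets_in N K. \<forall>p\<in>P. x \<le> (\<Sum>c\<in>#C. h p c)}"
  define F where "F p c = f (norm (c - p))" for p c :: "real ^ 'n"
  have \<Lambda>: "finite \<Lambda>" "\<Lambda> \<subseteq> ?H" "\<And>c. c \<in> ?H \<Longrightarrow> \<exists>s\<in>\<Lambda>. norm (s - c) < \<epsilon>\<^sub>\<Lambda>"
    and \<Gamma>: "finite \<Gamma>" "\<Gamma> \<subseteq> A" "\<And>p. p \<in> A \<Longrightarrow> \<exists>s\<in>\<Gamma>. norm (s - p) < \<epsilon>\<^sub>\<Gamma>"
    using assms unfolding eps_net_def by blast+
  have AH: "A \<subseteq> ?H" by (rule hull_subset)
  have ne: "?H \<noteq> {}" "\<Lambda> \<noteq> {}" "\<Gamma> \<noteq> {}"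
    using \<Lambda>(3) \<Gamma>(3) AH \<open>A \<noteq> {}\<close> by fastforce+
  have H: "compact ?H" "closed ?H" "convex ?H"
    using compact_convex_hull[OF \<open>compact A\<close>] by (auto intro: compact_imp_closed)
  have anti: "f v \<le> f u" if "0 \<le> u" "u \<le> v" for u v
    using monotone_onD[OF \<open>strict_antimono_on {0..} f\<close>, of u v] that
    by (cases "u = v") auto
  have F_nonneg: "0 \<le> F p c" for p c
    using \<open>f \<in> {0..} \<rightarrow> {0..}\<close> by (auto simp: F_def Pi_iff)
  have F_cont: "continuous_on K (F p)" for K p
    unfolding F_def
    by (rule continuous_on_compose2[OF \<open>continuous_on {0..} f\<close>]) (auto intro!: continuous_intros)
  have g_mono: "g c p u \<le> g c p v" if "c \<in> ?H" "p \<in> A" "0 \<le> u" "u \<le> v" for c p u v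
    using assms(11) that unfolding control_functions_def
    by (meson atLeast_iff mono_onD order_trans)
  \<comment> \<open>The control function is always taken at the net point: \<open>p\<close> will lie
    in \<Gamma> in the first bound, \<open>c\<close> in \<Lambda> in the second. Monotonicity then
    replaces the distance by the mesh of the net.\<close>
  have g_F: "F p c - g c p (norm (p - p')) \<le> F p' c" "F p c' \<le> F p c + g c p (norm (c - c'))"
    if "c \<in> ?H" "p \<in> A" "c' \<in> ?H" "p' \<in> A" for c p c' p'
    using assms(11) that unfolding control_functions_def F_def by (smt (verit))+

  obtain L\<^sub>1 where L1: "is_maximum (?S \<Lambda> \<Gamma> (\<lambda>p c. F p c - g c p \<epsilon>\<^sub>\<Gamma>)) L\<^sub>1"
    using maximum_over_msets_finite[OF \<Lambda>(1) ne(2) \<Gamma>(1) ne(3),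
        where h = "\<lambda>p c. F p c - g c p \<epsilon>\<^sub>\<Gamma>"] by blast
  obtain L\<^sub>2 where L2: "is_maximum (?S \<Lambda> A F) L\<^sub>2"
    using maximum_over_msets[where h = F, OF finite_imp_compact[OF \<Lambda>(1)] ne(2) \<open>A \<noteq> {}\<close> F_cont F_nonneg]
    by blast
  obtain U\<^sub>2 where U2: "is_maximum (?S ?H \<Gamma> F) U\<^sub>2"
    using maximum_over_msets[where h = F, OF H(1) ne(1,3) F_cont F_nonneg] by blast
  obtain U\<^sub>1 where U1: "is_maximum (?S \<Lambda> \<Gamma> (\<lambda>p c. F p c + g c p \<epsilon>\<^sub>\<Lambda>)) U\<^sub>1"
    using maximum_over_msets_finite[OF \<Lambda>(1) ne(2) \<Gamma>(1) ne(3),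
        where h = "\<lambda>p c. F p c + g c p \<epsilon>\<^sub>\<Lambda>"] by blast

  \<comment> \<open>A multiset attaining \<open>L\<^sub>1\<close> shows that
    \<open>L\<^sub>1\<close> is a feasible value for \<open>L\<^sub>2\<close>: each
    \<open>p'\<close> in \<open>A\<close> is compared with a nearby point of \<Gamma>.\<close>
  have le12: "L\<^sub>1 \<le> L\<^sub>2"
  proof -
    obtain C where C: "C \<in> msets_in N \<Lambda>"
      and le: "\<And>p. p \<in> \<Gamma> \<Longrightarrow> L\<^sub>1 \<le> (\<Sum>c\<in>#C. F p c - g c p \<epsilon>\<^sub>\<Gamma>)"
      using L1 unfolding is_maximum_def by blast
    have "L\<^sub>1 \<le> (\<Sum>c\<in>#C. F p' c)" if p': "p' \<in> A" for p'
    proof -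
      obtain p where p: "p \<in> \<Gamma>" "norm (p - p') < \<epsilon>\<^sub>\<Gamma>" using \<Gamma>(3)[OF p'] by blast
      have "F p c - g c p \<epsilon>\<^sub>\<Gamma> \<le> F p' c" if "c \<in># C" for c
      proof -
        have "c \<in> ?H" "p \<in> A" using that C \<Lambda>(2) \<Gamma>(2) p(1) by (auto simp: msets_in_def)
        then show ?thesis
          using g_mono[of c p "norm (p - p')" \<epsilon>\<^sub>\<Gamma>] g_F(1)[of c p c p'] p(2) p' by simp
      qed
      then show ?thesis using le[OF p(1)] by (meson order_trans sum_mset_mono)
    qed
    then show ?thesis using L2 C unfolding is_maximum_def by blast
  qed

  define I where "I C = (INF p\<in>A. \<Sum>c\<in>#C. F p c)" for C
  have pol: "polarization N f A = (SUP C\<in>msets_in N UNIV. I C)"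
    by (simp add: polarization_def I_def F_def msets_in_def norm_minus_commute)
  have I_lower: "I C \<le> (\<Sum>c\<in>#C. F p c)" if "p \<in> A" for C p
  proof -
    \<comment> \<open>Nonnegativity bounds the sums below, as an infimum in the reals
      requires.\<close>
    have "0 \<le> (\<Sum>c\<in>#C. F q c)" for q
      using sum_mset_mono[of C "\<lambda>_. 0" "F q"] F_nonneg by simp
    then show ?thesis
      unfolding I_def using that by (intro cINF_lower bdd_belowI2[where m = 0])
  qed
  have I_le: "I C \<le> U\<^sub>2" if C: "C \<in> msets_in N UNIV" for C
  proof -
    \<comment> \<open>Projection fixes points of \<open>A\<close> and is 1-Lipschitz, and
      \<open>f\<close> decreases, so no summand drops. Hence \<open>I C\<close> is a feasible value
      for \<open>U\<^sub>2\<close>, witnessed by \<open>?D\<close>.\<close>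
    let ?D = "image_mset (closest_point ?H) C"
    have "I C \<le> (\<Sum>c\<in>#?D. F p c)" if p: "p \<in> \<Gamma>" for p
    proof -
      have pA: "p \<in> A" using p \<Gamma>(2) by blast
      have "F p c \<le> F p (closest_point ?H c)" for c
        using closest_point_norm_le[OF H(2,3), of p c] pA AH
        by (auto simp: F_def norm_minus_commute intro!: anti)
      then have "(\<Sum>c\<in>#C. F p c) \<le> (\<Sum>c\<in>#C. F p (closest_point ?H c))"
        by (intro sum_mset_mono)
      then show ?thesis using I_lower[OF pA, of C] by (simp add: image_mset.compositionality o_def)
    qed
    moreover have "?D \<in> msets_in N ?H"
      using C closest_point_in_set[OF H(2) ne(1)] by (auto simp: msets_in_def)
    ultimately show ?thesis using U2 unfolding is_maximum_def by blast
  qed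
  have leP2: "polarization N f A \<le> U\<^sub>2"
  proof -
    \<comment> \<open>Any point would do: the supremum only has to range over a nonempty
      set.\<close>
    have "replicate_mset N undefined \<in> msets_in N UNIV" by (simp add: msets_in_def)
    then show ?thesis unfolding pol using I_le by (intro cSUP_least) blast+
  qed
  have le2P: "L\<^sub>2 \<le> polarization N f A"
  proof -
    obtain C where C: "C \<in> msets_in N \<Lambda>" and le: "\<And>p. p \<in> A \<Longrightarrow> L\<^sub>2 \<le> (\<Sum>c\<in>#C. F p c)"
      using L2 unfolding is_maximum_def by blast
    have "L\<^sub>2 \<le> I C" unfolding I_def using le \<open>A \<noteq> {}\<close> by (intro cINF_greatest)
    also have "I C \<le> polarization N f A"
      unfolding pol using C I_le
      \<comment> \<open>The bound by \<open>U\<^sub>2\<close> just proved supplies the boundedness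
        that the supremum needs.\<close>
      by (intro cSUP_upper bdd_aboveI2[where M = U\<^sub>2]) (auto simp: msets_in_def)
    finally show ?thesis .
  qed

  have le21: "U\<^sub>2 \<le> U\<^sub>1"
  proof -
    obtain C where C: "C \<in> msets_in N ?H"
      and le: "\<And>p. p \<in> \<Gamma> \<Longrightarrow> U\<^sub>2 \<le> (\<Sum>c\<in>#C. F p c)"
      using U2 unfolding is_maximum_def by blast
    \<comment> \<open>Rounding to \<Lambda> may merge points; the multiset image adds up their
      multiplicities, so the size stays \<open>N\<close>.\<close>
    obtain s where s: "\<And>c. c \<in> ?H \<Longrightarrow> s c \<in> \<Lambda> \<and> norm (s c - c) < \<epsilon>\<^sub>\<Lambda>"
      using \<Lambda>(3) by metis
    have "U\<^sub>2 \<le> (\<Sum>c\<in>#image_mset s C. F p c + g c p \<epsilon>\<^sub>\<Lambda>)" if p: "p \<in> \<Gamma>" for p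
    proof -
      have "F p c \<le> F p (s c) + g (s c) p \<epsilon>\<^sub>\<Lambda>" if "c \<in># C" for c
      proof -
        have *: "c \<in> ?H" "p \<in> A" using that C \<Gamma>(2) p by (auto simp: msets_in_def)
        then have "s c \<in> ?H" using s \<Lambda>(2) by blast
        then show ?thesis
          using g_mono[of "s c" p "norm (s c - c)" \<epsilon>\<^sub>\<Lambda>] g_F(2)[of "s c" p c p] s[OF *(1)] *
          by simp
      qed
      then have "(\<Sum>c\<in>#C. F p c) \<le> (\<Sum>c\<in>#C. F p (s c) + g (s c) p \<epsilon>\<^sub>\<Lambda>)"
        by (intro sum_mset_mono)
      then show ?thesis using le[OF p] by (simp add: image_mset.compositionality o_def)
    qed
    moreover have "image_mset s C \<in> msets_in N \<Lambda>"
      using C s by (auto simp: msets_in_def)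
    ultimately show ?thesis using U1 unfolding is_maximum_def by blast
  qed

  have hull_form: "?S ?H \<Gamma> F = {x. \<exists>C. size C = N \<and> set_mset C \<subseteq> ?H \<and>
      (\<forall>p\<in>\<Gamma>. x \<le> (\<Sum>c\<in>#C. F p c))}"
    by (auto simp: msets_in_def)
  show ?thesis
    using L1 L2 U2 U1 le12 le2P leP2 le21
    unfolding hull_form ex_weights_iff[OF \<Lambda>(1), symmetric] unfolding F_def
    by blast
qed

end
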